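(* Let $N,M\in\mathbb{N}$ and $x=(x_1,\dots,x_N)^\top\in\mathbb{Z}^N$ with $\|x\|_1\le M$. (1) If $N\ge M$, then for any $S,T\in\mathbb{N}$ there exists $g\in\mathcal{NN}_{1,1}(W,L)$ with \[ W=22\max\Big\{\Big\lceil\frac{\sqrt M}{S\sqrt{T+2}}\Big\rceil,\ \Big\lceil\Big(\frac NM\Big)^{1/T}\Big\rceil\Big\}+10,\qquad L=4S(T+2), \] such that $g(n)=x_n$ for $n=1,\dots,N$. (2) If $N\le M$, then for any $S,T\in\mathbb{N}$ there exists $g\in\mathcal{NN}_{1,1}(W,L)$ with \[ W=22\max\Big\{\Big\lceil\frac{M}{S\sqrt{N(T+2)}}\Big\rceil,\ \Big\lceil\Big(\frac MN\Big)^{1/T}\Big\rceil\Big\}+12,\qquad L=4\Big\lceil\frac{SN}{M}\Big\rceil(T+2), \] such that $g(n)=x_n$ for $n=1,\dots,N$.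
   Context: $\mathcal{NN}_{d,k}(W,L)$: set of maps $g:\mathbb{R}^d\to\mathbb{R}^k$ given by $g_0(x)=x$, $g_{\ell+1}(x)=\sigma(A_\ell g_\ell(x)+b_\ell)$ ($\ell=0,\dots,L-1$), $g(x)=A_Lg_L(x)+b_L$, with $A_\ell\in\mathbb{R}^{N_{\ell+1}\times N_\ell}$, $b_\ell\in\mathbb{R}^{N_{\ell+1}}$, $N_0=d$, $N_{L+1}=k$, $\max\{N_1,\dots,N_L\}\le W$, $\sigma(t)=\max\{t,0\}$ componentwise. *)

theory Defs
  imports Complex_Main
begin

text \<open>Feed-forward ReLU networks.  Vectors in R^m are represented as functions
  nat => real, of which only the entries with index < m are meaningful.
  A network with L hidden layers is given by widths Ns = [N_0, ..., N_(L+1)],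
  weight matrices As l (entries As l i j, i < N_(l+1), j < N_l) and biases bs l.\<close>

definition relu :: "real \<Rightarrow> real" where
  "relu t = max t 0"

fun nn_hidden :: "nat list \<Rightarrow> (nat \<Rightarrow> nat \<Rightarrow> nat \<Rightarrow> real) \<Rightarrow> (nat \<Rightarrow> nat \<Rightarrow> real)
    \<Rightarrow> nat \<Rightarrow> (nat \<Rightarrow> real) \<Rightarrow> (nat \<Rightarrow> real)" where
  "nn_hidden Ns As bs 0 x = x"
| "nn_hidden Ns As bs (Suc l) x =
     (\<lambda>i. if i < Ns ! Suc l
          then relu ((\<Sum>j<Ns ! l. As l i j * nn_hidden Ns As bs l x j) + bs l i)
          else 0)"

definition nn_eval :: "nat list \<Rightarrow> (nat \<Rightarrow> nat \<Rightarrow> nat \<Rightarrow> real) \<Rightarrow> (nat \<Rightarrow> nat \<Rightarrow> real)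
    \<Rightarrow> nat \<Rightarrow> (nat \<Rightarrow> real) \<Rightarrow> (nat \<Rightarrow> real)" where
  "nn_eval Ns As bs L x =
     (\<lambda>i. if i < Ns ! Suc L
          then (\<Sum>j<Ns ! L. As L i j * nn_hidden Ns As bs L x j) + bs L i
          else 0)"

definition NN :: "nat \<Rightarrow> nat \<Rightarrow> nat \<Rightarrow> nat \<Rightarrow> ((nat \<Rightarrow> real) \<Rightarrow> (nat \<Rightarrow> real)) set" where
  "NN d k W L = {g. \<exists>Ns As bs. length Ns = L + 2 \<and> Ns ! 0 = d \<and> Ns ! (L + 1) = k \<and>
       (\<forall>l\<in>{1..L}. Ns ! l \<le> W) \<and> (\<forall>x. g x = nn_eval Ns As bs L x)}"

end

theory Submission
  imports Defs
begin

text \<open>On the finite domain a layer of width \<open>2m\<close> can evaluate \<open>m\<close> gates \<open>[g \<ge> 0] \<cdot> f\<close> of functions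
  \<open>f, g\<close> that are affine in the previous layer, since such a gate is a difference of two ReLUs with
  a steep slope. The vector is written as a sequence of steps: a jump of the cursor by at most \<open>w ^ T\<close>
  positions followed by an addition of size at most \<open>w ^ T\<close>; there are \<open>O(w\<^sup>2 S\<^sup>2 (T + 2))\<close> of them. The
  positions are grouped into \<open>O(w\<^sup>2 S (T + 2))\<close> blocks; apart from its first position, a block
  contains fewer than \<open>S\<close> steps. Half of the depth maps \<open>n\<close> to the first position of its
  block, the entry there, and a number encoding the steps of the block, at a rate of
  \<open>O(w\<^sup>2)\<close> blocks per two layers. The other half executes the steps, each of which is
  read off as \<open>2T\<close> digits in base \<open>3w\<close>, one digit per layer.\<close>

section \<open>Gate layers\<close>

text \<open>The affine span of \<open>X\<close>, taken among functions on \<open>D\<close>: the rule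
  \<open>cong\<close> identifies functions that agree on \<open>D\<close>, so that identities valid
  only on the domain may be used.\<close>

inductive_set aspan :: "nat set \<Rightarrow> (nat \<Rightarrow> real) set \<Rightarrow> (nat \<Rightarrow> real) set"
  for D :: "nat set" and X :: "(nat \<Rightarrow> real) set" where
  base: "f \<in> X \<Longrightarrow> f \<in> aspan D X"
| const: "(\<lambda>_. c) \<in> aspan D X"
| add: "f \<in> aspan D X \<Longrightarrow> g \<in> aspan D X \<Longrightarrow> (\<lambda>n. f n + g n) \<in> aspan D X"
| scale: "f \<in> aspan D X \<Longrightarrow> (\<lambda>n. c * f n) \<in> aspan D X"
| cong: "f \<in> aspan D X \<Longrightarrow> (\<And>n. n \<in> D \<Longrightarrow> f n = g n) \<Longrightarrow> g \<in> aspan D X"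

lemma aspan_diff:
  assumes "f \<in> aspan D X" "g \<in> aspan D X"
  shows "(\<lambda>n. f n - g n) \<in> aspan D X"
  using aspan.add[OF assms(1) aspan.scale[OF assms(2), of "-1"]] by simp

lemma aspan_sum:
  assumes "finite A" "\<And>i. i \<in> A \<Longrightarrow> f i \<in> aspan D X"
  shows "(\<lambda>n. \<Sum>i\<in>A. f i n) \<in> aspan D X"
  using assms
proof (induction A rule: finite_induct)
  case empty
  then show ?case using aspan.const[of 0] by simp
next
  case (insert a A)
  then have "(\<lambda>n. f a n + (\<Sum>i\<in>A. f i n)) \<in> aspan D X"
    by (intro aspan.add) auto
  then show ?case using insert by simp
qed

lemma aspan_trans:
  assumes "f \<in> aspan D X" "X \<subseteq> aspan D Y"
  shows "f \<in> aspan D Y"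
  using assms(1)
proof induction
  case (cong f g)
  then show ?case using aspan.cong by blast
qed (use assms(2) in \<open>auto intro: aspan.const aspan.add aspan.scale\<close>)

text \<open>The coefficients become the weights and the bias of one neuron that reads a layer listed
  in the order of \<open>F\<close>.\<close>

lemma aspan_list_repr:
  assumes "f \<in> aspan D (set F)"
  shows "\<exists>c b. \<forall>n\<in>D. f n = (\<Sum>i<length F. c i * (F ! i) n) + b"
  using assms
proof induction
  case (base f)
  then obtain k where k: "k < length F" "f = F ! k" by (auto simp: in_set_conv_nth)
  have "\<forall>n\<in>D. f n = (\<Sum>i<length F. of_bool (i = k) * (F ! i) n) + 0"
    using k by (simp add: of_bool_def if_distrib[of "\<lambda>x. x * _"] cong: if_cong)
  then show ?case by (intro exI[of _ "\<lambda>i. of_bool (i = k)"] exI[of _ 0])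
next
  case (const c)
  have "\<forall>n\<in>D. c = (\<Sum>i<length F. 0 * (F ! i) n) + c" by simp
  then show ?case by (intro exI[of _ "\<lambda>_. 0"] exI[of _ c])
next
  case (add f g)
  then obtain c b c' b' where
    *: "\<forall>n\<in>D. f n = (\<Sum>i<length F. c i * (F ! i) n) + b"
    "\<forall>n\<in>D. g n = (\<Sum>i<length F. c' i * (F ! i) n) + b'" by blast
  have "\<forall>n\<in>D. f n + g n = (\<Sum>i<length F. (c i + c' i) * (F ! i) n) + (b + b')"
    using * by (simp add: sum.distrib ring_distribs)
  then show ?case by (intro exI[of _ "\<lambda>i. c i + c' i"] exI[of _ "b + b'"])
next
  case (scale f k)
  then obtain c b where *: "\<forall>n\<in>D. f n = (\<Sum>i<length F. c i * (F ! i) n) + b" by blast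
  have "\<forall>n\<in>D. k * f n = (\<Sum>i<length F. (k * c i) * (F ! i) n) + k * b"
    using * by (simp add: sum_distrib_left ring_distribs mult.assoc)
  then show ?case by (intro exI[of _ "\<lambda>i. k * c i"] exI[of _ "k * b"])
next
  case (cong f g)
  then show ?case by metis
qed

section \<open>Networks built layer by layer from gates\<close>

text \<open>\<open>F\<close> lists the neurons of hidden layer \<open>L\<close> after activation. No
  output layer is attached yet, so that a network can grow by one layer at a time; for
  \<open>L = 0\<close> the layer is the input itself.\<close>

definition reaches :: "nat set \<Rightarrow> nat \<Rightarrow> nat \<Rightarrow> (nat \<Rightarrow> real) list \<Rightarrow> bool" where
  "reaches D W L F \<longleftrightarrow> (\<exists>Ns As bs. length Ns = Suc L \<and> Ns ! 0 = 1 \<and> Ns ! L = length F \<and>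
     (\<forall>l\<in>{1..L}. Ns ! l \<le> W) \<and>
     (\<forall>n\<in>D. \<forall>i<length F. nn_hidden Ns As bs L (\<lambda>_. real n) i = (F ! i) n))"

text \<open>Allows a layer to be appended: data at later indices do not influence layer
  \<open>L\<close>.\<close>

lemma nn_hidden_cong:
  assumes "\<And>l. l \<le> L \<Longrightarrow> Ns ! l = Ns' ! l" "\<And>l. l < L \<Longrightarrow> As l = As' l"
    "\<And>l. l < L \<Longrightarrow> bs l = bs' l"
  shows "nn_hidden Ns As bs L x = nn_hidden Ns' As' bs' L x"
  using assms by (induction L) auto

lemma reaches_Suc:
  assumes "reaches D W L F" "length G \<le> W"
    and G: "\<And>g. g \<in> set G \<Longrightarrow> \<exists>h\<in>aspan D (set F). \<forall>n\<in>D. g n = relu (h n)"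
  shows "reaches D W (Suc L) G"
proof -
  obtain Ns As bs where N: "length Ns = Suc L" "Ns ! 0 = 1" "Ns ! L = length F"
     "\<forall>l\<in>{1..L}. Ns ! l \<le> W"
     "\<forall>n\<in>D. \<forall>i<length F. nn_hidden Ns As bs L (\<lambda>_. real n) i = (F ! i) n"
    using assms(1) unfolding reaches_def by blast
  have "\<exists>c b. \<forall>n\<in>D. (G ! k) n = relu ((\<Sum>i<length F. c i * (F ! i) n) + b)"
    if k: "k < length G" for k
  proof -
    obtain h where h: "h \<in> aspan D (set F)" "\<forall>n\<in>D. (G ! k) n = relu (h n)"
      using G[OF nth_mem[OF k]] by blast
    with aspan_list_repr[OF h(1)] show ?thesis by metis
  qed
  then obtain c b where cb: "\<And>k n. k < length G \<Longrightarrow> n \<in> D \<Longrightarrow>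
      (G ! k) n = relu ((\<Sum>i<length F. c k i * (F ! i) n) + b k)" by metis
  let ?Ns = "Ns @ [length G]" and ?As = "As(L := c)" and ?bs = "bs(L := b)"
  have hid: "nn_hidden ?Ns ?As ?bs L x = nn_hidden Ns As bs L x" for x
    by (rule nn_hidden_cong) (auto simp: nth_append N)
  have "\<forall>n\<in>D. \<forall>i<length G. nn_hidden ?Ns ?As ?bs (Suc L) (\<lambda>_. real n) i = (G ! i) n"
    using N cb by (simp add: hid nth_append)
  moreover have "\<forall>l\<in>{1..Suc L}. ?Ns ! l \<le> W"
    using N assms(2) by (auto simp: nth_append)
  moreover have "length ?Ns = Suc (Suc L)" "?Ns ! 0 = 1" "?Ns ! Suc L = length G"
    using N by (simp_all add: nth_append)
  ultimately show ?thesis unfolding reaches_def by blast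
qed

lemma reaches_output:
  assumes "reaches D W L F" "f \<in> aspan D (set F)"
  shows "\<exists>g\<in>NN 1 1 W L. \<forall>n\<in>D. g (\<lambda>_. real n) 0 = f n"
proof -
  obtain Ns As bs where N: "length Ns = Suc L" "Ns ! 0 = 1" "Ns ! L = length F"
     "\<forall>l\<in>{1..L}. Ns ! l \<le> W"
     "\<forall>n\<in>D. \<forall>i<length F. nn_hidden Ns As bs L (\<lambda>_. real n) i = (F ! i) n"
    using assms(1) unfolding reaches_def by blast
  obtain c b where cb: "\<forall>n\<in>D. f n = (\<Sum>i<length F. c i * (F ! i) n) + b"
    using aspan_list_repr[OF assms(2)] by blast
  let ?Ns = "Ns @ [1]" and ?As = "As(L := \<lambda>_. c)" and ?bs = "bs(L := \<lambda>_. b)"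
  let ?g = "nn_eval ?Ns ?As ?bs L"
  have hid: "nn_hidden ?Ns ?As ?bs L x = nn_hidden Ns As bs L x" for x
    by (rule nn_hidden_cong) (auto simp: nth_append N)
  have "?g \<in> NN 1 1 W L" unfolding NN_def mem_Collect_eq
    by (intro exI[of _ ?Ns] exI[of _ ?As] exI[of _ ?bs])
       (use N in \<open>auto simp: nth_append\<close>)
  moreover have "\<forall>n\<in>D. ?g (\<lambda>_. real n) 0 = f n"
    using N cb by (simp add: nn_eval_def hid nth_append del: One_nat_def)
  ultimately show ?thesis by blast
qed

text \<open>The functions in \<open>X\<close> need only be affine read-outs of the last layer, since
  the next layer absorbs an affine map. The width is \<open>2 * m\<close> because one gate takes two
  neurons.\<close>

definition computable :: "nat set \<Rightarrow> nat \<Rightarrow> nat \<Rightarrow> (nat \<Rightarrow> real) set \<Rightarrow> bool" where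
  "computable D m L X \<longleftrightarrow> (\<exists>F. reaches D (2 * m) L F \<and> X \<subseteq> aspan D (set F))"

lemma computable_aspan:
  assumes "computable D m L X" "Y \<subseteq> aspan D X"
  shows "computable D m L Y"
  using assms aspan_trans unfolding computable_def by blast

lemma computable_0: "computable D m 0 {real}"
proof -
  have "reaches D (2 * m) 0 [real]"
    unfolding reaches_def by (intro exI[of _ "[1]"]) simp
  then show ?thesis
    unfolding computable_def by (intro exI[of _ "[real]"]) (simp add: aspan.base)
qed

text \<open>Take \<open>C\<close> above all \<open>\<bar>f n\<bar>\<close> and \<open>K\<close> so
  steep that \<open>K * g n \<le> - 2 * C\<close> wherever \<open>g n < 0\<close>. An open gate has
  two nonnegative arguments, which differ by \<open>f n\<close>; a closed gate has two nonpositive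
  ones. Both constants exist because \<open>D\<close> is finite.\<close>

lemma gate_relu:
  assumes "finite (D :: nat set)"
  shows "\<exists>C K :: real. \<forall>n\<in>D. (if g n \<ge> 0 then f n else 0) =
           relu (f n + C + K * g n) - relu (C + K * g n)"
proof -
  define C where "C = (\<Sum>n\<in>D. \<bar>f n\<bar>)"
  \<comment> \<open>Each point with \<open>g n < 0\<close> contributes the slope that it requires;
    the summands are nonnegative, so the sum dominates each of them.\<close>
  define K where "K = (\<Sum>n\<in>D. if g n < 0 then 2 * C / - g n else 0)"
  have C: "\<bar>f n\<bar> \<le> C" if "n \<in> D" for n
    unfolding C_def by (rule member_le_sum[of n D "\<lambda>n. \<bar>f n\<bar>"]) (use that assms in auto)
  have C0: "C \<ge> 0" unfolding C_def by (simp add: sum_nonneg)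
  have K0: "K \<ge> 0" unfolding K_def using C0 by (intro sum_nonneg) (auto intro: divide_nonneg_neg)
  have K: "K * g n \<le> - 2 * C" if "n \<in> D" "g n < 0" for n
  proof -
    have "(if g n < 0 then 2 * C / - g n else 0) \<le> K"
      unfolding K_def by (rule member_le_sum) (use that assms C0 in \<open>auto intro: divide_nonneg_neg\<close>)
    then have "2 * C / - g n \<le> K" using that by simp
    then show ?thesis using that by (simp add: field_simps)
  qed
  have "(if g n \<ge> 0 then f n else 0) = relu (f n + C + K * g n) - relu (C + K * g n)"
    if "n \<in> D" for n
  proof (cases "g n \<ge> 0")
    case True
    then have "K * g n \<ge> 0" using K0 by simp
    then show ?thesis using C[OF that] True C0 by (simp add: relu_def)
  next
    case False
    then have "K * g n \<le> - 2 * C" using K that by simp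
    then show ?thesis using C[OF that] False C0 by (simp add: relu_def)
  qed
  then show ?thesis by blast
qed

text \<open>The two ReLU arguments of \<open>gate_relu\<close> are affine in the previous layer, so
  each function of \<open>Y\<close> takes two neurons of \<open>G\<close> and is recovered as their
  difference.\<close>

lemma computable_Suc:
  assumes "computable D m L X" "finite D" "finite Y" "card Y \<le> m"
    and Y: "\<And>y. y \<in> Y \<Longrightarrow> \<exists>f\<in>aspan D X. \<exists>g\<in>aspan D X. \<forall>n\<in>D. y n = (if g n \<ge> 0 then f n else 0)"
  shows "computable D m (Suc L) Y"
proof -
  obtain F where F: "reaches D (2 * m) L F" "X \<subseteq> aspan D (set F)"
    using assms(1) unfolding computable_def by blast
  have "\<exists>p q. p \<in> aspan D (set F) \<and> q \<in> aspan D (set F) \<and>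
          (\<forall>n\<in>D. y n = relu (p n) - relu (q n))" if "y \<in> Y" for y
  proof -
    obtain f g where fg: "f \<in> aspan D X" "g \<in> aspan D X"
      "\<forall>n\<in>D. y n = (if g n \<ge> 0 then f n else 0)" using Y[OF \<open>y \<in> Y\<close>] by blast
    obtain C K where CK: "\<forall>n\<in>D. (if g n \<ge> 0 then f n else 0) =
           relu (f n + C + K * g n) - relu (C + K * g n)"
      using gate_relu[OF assms(2)] by blast
    have "f \<in> aspan D (set F)" "g \<in> aspan D (set F)" using fg F(2) aspan_trans by blast+
    then have "(\<lambda>n. f n + C + K * g n) \<in> aspan D (set F)" "(\<lambda>n. C + K * g n) \<in> aspan D (set F)"
      by (simp_all add: aspan.add aspan.scale aspan.const)
    then show ?thesis using fg CK
      by (intro exI[of _ "\<lambda>n. f n + C + K * g n"] exI[of _ "\<lambda>n. C + K * g n"]) simp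
  qed
  then obtain p q where pq: "\<And>y. y \<in> Y \<Longrightarrow> p y \<in> aspan D (set F)"
    "\<And>y. y \<in> Y \<Longrightarrow> q y \<in> aspan D (set F)"
    "\<And>y n. y \<in> Y \<Longrightarrow> n \<in> D \<Longrightarrow> y n = relu (p y n) - relu (q y n)" by metis
  obtain ys where ys: "set ys = Y" "distinct ys" using assms(3) finite_distinct_list by blast
  define G where "G = map (\<lambda>y n. relu (p y n)) ys @ map (\<lambda>y n. relu (q y n)) ys"
  have len: "length G \<le> 2 * m" using ys assms(4) distinct_card unfolding G_def by force
  have "reaches D (2 * m) (Suc L) G"
    by (rule reaches_Suc[OF F(1) len]) (use pq ys in \<open>auto simp: G_def\<close>)
  moreover have "Y \<subseteq> aspan D (set G)"
  proof
    fix y assume y: "y \<in> Y"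
    have "(\<lambda>n. relu (p y n) - relu (q y n)) \<in> aspan D (set G)"
      by (rule aspan_diff; rule aspan.base) (use y ys in \<open>auto simp: G_def\<close>)
    then show "y \<in> aspan D (set G)" by (rule aspan.cong) (use pq y in auto)
  qed
  ultimately show ?thesis unfolding computable_def by blast
qed

text \<open>A gate controlled by the constant 0 is always open, so a value can be carried to the
  next layer at the price of one gate.\<close>

lemma carry_gate:
  assumes "f \<in> aspan D X"
  shows "\<exists>f'\<in>aspan D X. \<exists>g\<in>aspan D X. \<forall>n\<in>D. f n = (if g n \<ge> 0 then f' n else 0)"
  by (rule bexI[OF _ assms], rule bexI[OF _ aspan.const[of 0]]) simp

text \<open>\<open>NN\<close> fixes the depth exactly; surplus layers merely carry the
  values.\<close>

lemma computable_pad: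
  assumes "computable D m L X" "finite D" "finite X" "card X \<le> m" "L \<le> L'"
  shows "computable D m L' X"
  using assms(5)
proof (induction L' rule: dec_induct)
  case (step k)
  show ?case
    by (rule computable_Suc[OF step.IH assms(2-4)]) (blast intro: carry_gate aspan.base)
qed (use assms in simp)

section \<open>Threshold indicators\<close>

text \<open>The indicators keep exactly the increments up to \<open>min a k\<close>, and the sum
  telescopes. Hence an arbitrary function of an index is affine in the indicators of its
  thresholds.\<close>

lemma telescope_min:
  fixes \<Phi> :: "nat \<Rightarrow> real"
  shows "\<Phi> (min a k) = \<Phi> 0 + (\<Sum>j\<in>{1..k}. of_bool (j \<le> a) * (\<Phi> j - \<Phi> (j - 1)))"
proof (induction k)
  case (Suc k)
  show ?case
  proof (cases "Suc k \<le> a")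
    case True
    then show ?thesis using Suc by (simp add: min_def)
  next
    case False
    then have "min a (Suc k) = min a k" by simp
    then show ?thesis using Suc False by simp
  qed
qed simp

text \<open>Monotonicity makes the set where \<open>t \<le> r n\<close> upward closed, so its least
  element is the threshold. If the set is empty, any number above the finite set \<open>D\<close>
  serves.\<close>

lemma mono_threshold:
  assumes "mono (r :: nat \<Rightarrow> nat)" "finite D"
  shows "\<exists>\<tau>::real. \<forall>n\<in>D. t \<le> r n \<longleftrightarrow> \<tau> \<le> real n"
proof (cases "\<exists>n. t \<le> r n")
  case True
  define k where "k = (LEAST n. t \<le> r n)"
  have k: "t \<le> r k" unfolding k_def using True by (rule LeastI_ex)
  have "t \<le> r n \<longleftrightarrow> real k \<le> real n" for n
  proof
    show "real k \<le> real n" if "t \<le> r n"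
      unfolding k_def using Least_le[of "\<lambda>n. t \<le> r n", OF that] by simp
    show "t \<le> r n" if "real k \<le> real n"
      using k monoD[OF assms(1), of k n] that by simp
  qed
  then show ?thesis by blast
next
  case False
  obtain b where b: "\<forall>n\<in>D. n < b" using assms(2)[unfolded finite_nat_set_iff_bounded] ..
  have "\<forall>n\<in>D. t \<le> r n \<longleftrightarrow> real b \<le> real n"
  proof
    fix n assume "n \<in> D"
    with b have "n < b" by (rule bspec)
    with False show "t \<le> r n \<longleftrightarrow> real b \<le> real n" by simp
  qed
  then show ?thesis by (rule exI)
qed

section \<open>Encoding blocks\<close>

lemma gateI:
  assumes "f \<in> aspan D X" "g \<in> aspan D X" "\<forall>n\<in>D. y n = (if g n \<ge> 0 then f n else 0)"
  shows "\<exists>f\<in>aspan D X. \<exists>g\<in>aspan D X. \<forall>n\<in>D. y n = (if g n \<ge> 0 then f n else 0)"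
  using assms by (intro bexI[of _ f] bexI[of _ g])

lemma aspan_insertI: "f \<in> aspan D (insert f X)"
  by (rule aspan.base) simp

text \<open>A table lookup: once the indicators are available, every table \<open>\<Phi>\<close> is
  read from the same \<open>k\<close> functions without a further layer.\<close>

lemma aspan_telescope:
  fixes \<Phi> :: "nat \<Rightarrow> real"
  assumes "\<And>j. j \<in> {1..k} \<Longrightarrow> (\<lambda>n. of_bool (j \<le> a n)) \<in> aspan D X"
  shows "(\<lambda>n. \<Phi> (min (a n) k)) \<in> aspan D X"
proof -
  have "(\<lambda>n. (\<Phi> j - \<Phi> (j - 1)) * of_bool (j \<le> a n)) \<in> aspan D X" if "j \<in> {1..k}" for j
    by (rule aspan.scale[OF assms[OF that]])
  then have "(\<lambda>n. \<Sum>j\<in>{1..k}. (\<Phi> j - \<Phi> (j - 1)) * of_bool (j \<le> a n)) \<in> aspan D X"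
    by (intro aspan_sum) auto
  from aspan.add[OF aspan.const[of "\<Phi> 0"] this] show ?thesis
    by (simp add: telescope_min[of \<Phi> _ k] mult.commute)
qed

text \<open>The first layer finds the group of \<open>k\<close> consecutive thresholds that contains \<open>r n\<close>; every
  function of the group index is affine in its gates. The second layer compares with the
  thresholds of that group, gating the corresponding increments of \<open>h\<close>.\<close>

lemma encode_stage:
  fixes r :: "nat \<Rightarrow> nat" and h :: "nat \<Rightarrow> real"
  assumes computable: "computable D m L (insert (\<lambda>n. h (min (r n) b)) C)"
    and D: "finite D" and C: "finite C" "real \<in> C" and r: "mono r"
    and k: "k \<ge> 1" "card C + k + 1 \<le> m"
  shows "computable D m (L + 2) (insert (\<lambda>n. h (min (r n) (b + k * k))) C)"
proof -
  let ?acc = "\<lambda>n. h (min (r n) b)"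
  have "\<exists>\<tau>::real. \<forall>n\<in>D. t \<le> r n \<longleftrightarrow> \<tau> \<le> real n" for t
    by (rule mono_threshold[OF r D])
  then obtain \<tau> :: "nat \<Rightarrow> real" where \<tau>: "\<And>t n. n \<in> D \<Longrightarrow> t \<le> r n \<longleftrightarrow> \<tau> t \<le> real n" by metis
  \<comment> \<open>\<open>a n\<close> is the index of the group reached by \<open>r n\<close>,
    \<open>J n\<close> caps it at the last group, and the thresholds of that group are
    \<open>\<beta> n + i\<close> with \<open>i\<close> from 1 to \<open>k\<close>.\<close>
  define a where "a n = (r n - b) div k" for n
  define J where "J n = min (a n) (k - 1)" for n
  define \<beta> where "\<beta> n = b + J n * k" for n
  define X1 where "X1 = insert ?acc C \<union> (\<lambda>j n. of_bool (j \<le> a n)) ` {1..k-1}"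
  have cardX1: "card X1 \<le> m"
  proof -
    have "card X1 \<le> card (insert ?acc C) + card ((\<lambda>j n. of_bool (j \<le> a n) :: real) ` {1..k-1})"
      unfolding X1_def by (rule card_Un_le)
    also have "\<dots> \<le> Suc (card C) + (k - 1)"
      using card_image_le[of "{1..k-1}" "\<lambda>j n. of_bool (j \<le> a n) :: real"] C
      by (intro add_mono) (auto simp: card_insert_if)
    finally show ?thesis using k by simp
  qed
  \<comment> \<open>Subtraction is truncated here: \<open>j \<ge> 1\<close> makes
    \<open>j * k\<close> positive and so excludes \<open>r n < b\<close>.\<close>
  have a_iff: "j \<le> a n \<longleftrightarrow> b + j * k \<le> r n" if "j \<ge> 1" for j n
  proof -
    have "j * k \<ge> 1" using that k by simp
    moreover have "j \<le> a n \<longleftrightarrow> j * k \<le> r n - b"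
      using k unfolding a_def by (simp add: less_eq_div_iff_mult_less_eq)
    ultimately show ?thesis by linarith
  qed
  have gm1: "computable D m (Suc L) X1"
  proof (rule computable_Suc[OF computable D _ cardX1])
    show "finite X1" using C by (simp add: X1_def)
    fix y assume "y \<in> X1"
    then consider "y \<in> insert ?acc C" | j where "j \<in> {1..k-1}" "y = (\<lambda>n. of_bool (j \<le> a n))"
      unfolding X1_def by blast
    then show "\<exists>f\<in>aspan D (insert ?acc C). \<exists>g\<in>aspan D (insert ?acc C).
        \<forall>n\<in>D. y n = (if g n \<ge> 0 then f n else 0)"
    proof cases
      case 1
      then show ?thesis by (intro carry_gate aspan.base)
    next
      case 2
      have "real \<in> aspan D (insert ?acc C)" using C by (intro aspan.base) simp
      then have "(\<lambda>n. real n - \<tau> (b + j * k)) \<in> aspan D (insert ?acc C)"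
        by (rule aspan_diff[OF _ aspan.const])
      moreover have "\<forall>n\<in>D. y n = (if real n - \<tau> (b + j * k) \<ge> 0 then 1 else 0)"
        using 2 \<tau> a_iff by auto
      ultimately show ?thesis by (rule gateI[OF aspan.const[of 1]])
    qed
  qed
  have fJ: "(\<lambda>n. \<Phi> (J n)) \<in> aspan D X1" for \<Phi>
    unfolding J_def
    by (rule aspan_telescope) (rule aspan.base, unfold X1_def, rule UnI2, rule imageI)
  define inc where "inc i n = of_bool (i \<le> r n - \<beta> n) * (h (\<beta> n + i) - h (\<beta> n + (i - 1)))" for i n
  define acc where "acc n = ?acc n + (h (\<beta> n) - h b)" for n
  define X2 where "X2 = insert acc C \<union> inc ` {1..k}"
  have cardX2: "card X2 \<le> m"
  proof -
    have "card X2 \<le> card (insert acc C) + card (inc ` {1..k})"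
      unfolding X2_def by (rule card_Un_le)
    also have "\<dots> \<le> Suc (card C) + k"
      using card_image_le[of "{1..k}" inc] C
      by (intro add_mono) (auto simp: card_insert_if)
    finally show ?thesis using k by simp
  qed
  have gm2: "computable D m (Suc (Suc L)) X2"
  proof (rule computable_Suc[OF gm1 D _ cardX2])
    show "finite X2" using C by (simp add: X2_def)
    fix y assume "y \<in> X2"
    then consider "y = acc" | "y \<in> C" | i where "i \<in> {1..k}" "y = inc i"
      unfolding X2_def by blast
    then show "\<exists>f\<in>aspan D X1. \<exists>g\<in>aspan D X1. \<forall>n\<in>D. y n = (if g n \<ge> 0 then f n else 0)"
    proof cases
      case 1
      have "?acc \<in> aspan D X1" by (rule aspan.base) (simp add: X1_def)
      moreover have "(\<lambda>n. h (\<beta> n) - h b) \<in> aspan D X1"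
        using fJ[of "\<lambda>J. h (b + J * k) - h b"] by (simp add: \<beta>_def)
      ultimately have "acc \<in> aspan D X1" unfolding acc_def by (rule aspan.add)
      then show ?thesis using 1 carry_gate by blast
    next
      case 2
      then show ?thesis by (intro carry_gate aspan.base) (simp add: X1_def)
    next
      case 3
      have "real \<in> aspan D X1" using C by (intro aspan.base) (simp add: X1_def)
      \<comment> \<open>The threshold varies with \<open>n\<close>, but only through
        \<open>J n\<close>. It is therefore affine in the first layer, and one gate can test
        \<open>n\<close> against the threshold of its own group.\<close>
      moreover have "(\<lambda>n. \<tau> (\<beta> n + i)) \<in> aspan D X1"
        using fJ[of "\<lambda>J. \<tau> (b + J * k + i)"] by (simp add: \<beta>_def)
      ultimately have g: "(\<lambda>n. real n - \<tau> (\<beta> n + i)) \<in> aspan D X1" by (rule aspan_diff)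
      have f: "(\<lambda>n. h (\<beta> n + i) - h (\<beta> n + (i - 1))) \<in> aspan D X1"
        using fJ[of "\<lambda>J. h (b + J * k + i) - h (b + J * k + (i - 1))"] by (simp add: \<beta>_def)
      have "i \<le> r n - \<beta> n \<longleftrightarrow> \<tau> (\<beta> n + i) \<le> real n" if "n \<in> D" for n
        using 3 \<tau>[OF that, of "\<beta> n + i"] by auto
      then have "\<forall>n\<in>D. y n = (if real n - \<tau> (\<beta> n + i) \<ge> 0 then h (\<beta> n + i) - h (\<beta> n + (i - 1)) else 0)"
        using 3 by (simp add: inc_def)
      then show ?thesis by (rule gateI[OF f g])
    qed
  qed
  have val: "h (min (r n) (b + k * k)) = acc n + (\<Sum>i\<in>{1..k}. inc i n)" for n
  proof -
    have "h (\<beta> n + min (r n - \<beta> n) k) = h (\<beta> n) + (\<Sum>i\<in>{1..k}. inc i n)"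
      using telescope_min[of "\<lambda>i. h (\<beta> n + i)" "r n - \<beta> n" k] by (simp add: inc_def)
    moreover have "?acc n + h (\<beta> n + min (r n - \<beta> n) k) - h b = h (min (r n) (b + k * k))"
    proof (cases "r n \<le> b")
      case True
      then have "\<beta> n = b" by (simp add: \<beta>_def J_def a_def)
      then show ?thesis using True by (simp add: min_def)
    next
      case False
      have "\<beta> n + min (r n - \<beta> n) k = min (r n) (b + k * k)"
      \<comment> \<open>Either \<open>r n\<close> lies within its group and the count inside the
        group recovers it, or all \<open>k * k\<close> thresholds are passed and the last group
        contributes all its increments.\<close>
      proof (cases "a n \<le> k - 1")
        case True
        then have "\<beta> n = b + (r n - b) div k * k" by (simp add: \<beta>_def J_def a_def)
        moreover have "r n - b = (r n - b) div k * k + (r n - b) mod k" by simp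
        moreover have "(r n - b) mod k < k" using k by simp
        ultimately have "\<beta> n \<le> r n" "r n - \<beta> n < k" using False by linarith+
        moreover have "\<not> k \<le> a n" using True k by linarith
        then have "r n < b + k * k" using a_iff[of k n] k by simp
        ultimately show ?thesis by simp
      next
        case outside: False
        then have "J n = k - 1" "k \<le> a n" by (simp_all add: J_def)
        then have "\<beta> n + k = b + k * k" "b + k * k \<le> r n"
          using a_iff[of k n] k by (cases k; simp add: \<beta>_def)+
        then show ?thesis by simp
      qed
      then show ?thesis using False by (simp add: min_def)
    qed
    ultimately show ?thesis by (simp add: acc_def)
  qed
  have "acc \<in> aspan D X2" by (rule aspan.base) (simp add: X2_def)
  moreover have "(\<lambda>n. \<Sum>i\<in>{1..k}. inc i n) \<in> aspan D X2"
    by (rule aspan_sum) (auto simp: X2_def intro: aspan.base)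
  ultimately have "(\<lambda>n. h (min (r n) (b + k * k))) \<in> aspan D X2"
    unfolding val by (rule aspan.add)
  moreover have "C \<subseteq> aspan D X2" by (auto simp: X2_def intro: aspan.base)
  ultimately show ?thesis using computable_aspan[OF gm2] by simp
qed

text \<open>Each stage of two layers raises the cap on \<open>r n\<close> by \<open>k * k\<close>.
  The cap starts at 0, where the function is the constant \<open>h 0\<close>, and after
  \<open>P\<close> stages it no longer cuts anything off on \<open>D\<close>.\<close>

lemma encode_monotone:
  fixes r :: "nat \<Rightarrow> nat" and h :: "nat \<Rightarrow> real"
  assumes computable: "computable D m L C" and "finite D" "finite C" "real \<in> C" "mono r" "k \<ge> 1" "card C + k + 1 \<le> m"
    and bound: "\<And>n. n \<in> D \<Longrightarrow> r n \<le> P * (k * k)"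
  shows "computable D m (L + 2 * P) (insert (\<lambda>n. h (r n)) C)"
proof -
  have "computable D m (L + 2 * p) (insert (\<lambda>n. h (min (r n) (p * (k * k)))) C)" for p
  proof (induction p)
    case 0
    have "insert (\<lambda>n. h (min (r n) 0)) C \<subseteq> aspan D C"
      using aspan.base aspan.const[of "h 0"] by auto
    then show ?case using computable_aspan[OF computable] by simp
  next
    case (Suc p)
    show ?case using encode_stage[OF Suc assms(2-7)] by (simp add: algebra_simps)
  qed
  from this[of P] show ?thesis
  proof (rule computable_aspan)
    have "(\<lambda>n. h (r n)) \<in> aspan D (insert (\<lambda>n. h (min (r n) (P * (k * k)))) C)"
      by (rule aspan.cong[OF aspan_insertI]) (use bound in \<open>simp add: min_def\<close>)
    then show "insert (\<lambda>n. h (r n)) C \<subseteq> aspan D (insert (\<lambda>n. h (min (r n) (P * (k * k)))) C)"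
      by (auto intro: aspan.base)
  qed
qed

section \<open>Removing leading digits\<close>

text \<open>The quotient \<open>y div q\<close> is below \<open>B\<close>, so it is the number of
  positive multiples \<open>j * q\<close> with \<open>j < B\<close> that do not exceed
  \<open>y\<close>; one layer of comparisons yields the remainder.\<close>

lemma mod_via_leading_digit:
  fixes y q B :: nat
  assumes "y < q * B"
  shows "real (y mod q) = real y - real q * (\<Sum>j\<in>{1..B-1}. of_bool (j * q \<le> y))"
proof -
  have q: "q > 0" using assms by (cases q) auto
  have "y div q \<le> B - 1" using assms q by (metis div_less_iff_less_mult mult.commute Suc_pred' less_Suc_eq_le bot_nat_0.not_eq_extremum mult_0_right not_less0)
  then have "real (y div q) = (\<Sum>j\<in>{1..B-1}. of_bool (j \<le> y div q))"
    using telescope_min[of real "y div q" "B - 1"] by (simp add: min_def of_nat_diff)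
  also have "\<dots> = (\<Sum>j\<in>{1..B-1}. of_bool (j * q \<le> y))"
    using q by (simp add: less_eq_div_iff_mult_less_eq)
  finally show ?thesis
    by (metis add_diff_cancel_left' mult.commute of_nat_add of_nat_mult mult_div_mod_eq)
qed

text \<open>One leading digit in base \<open>B\<close> is removed per layer. Thus a quotient of size
  up to \<open>B ^ T\<close> is stripped off with \<open>T\<close> layers of about \<open>B\<close>
  gates. The successive moduli \<open>q * B ^ T\<close> are multiples of \<open>q\<close>, so the
  final remainder is unaffected.\<close>

lemma extract_mod:
  fixes y :: "nat \<Rightarrow> nat"
  assumes "computable D m L (insert (\<lambda>n. real (y n)) C)"
    and "finite D" "finite C" "card C + B \<le> m" "B \<ge> 1"
    and "\<And>n. n \<in> D \<Longrightarrow> y n < q * B ^ T"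
  shows "computable D m (L + T) (insert (\<lambda>n. real (y n mod q)) C)"
  using assms(1,6)
proof (induction T arbitrary: L y)
  case 0
  have "(\<lambda>n. real (y n mod q)) \<in> aspan D (insert (\<lambda>n. real (y n)) C)"
    by (rule aspan.cong[OF aspan_insertI]) (use 0 in simp)
  then have "insert (\<lambda>n. real (y n mod q)) C \<subseteq> aspan D (insert (\<lambda>n. real (y n)) C)"
    by (auto intro: aspan.base)
  then show ?case using computable_aspan[OF 0(1)] by simp
next
  case (Suc T)
  let ?X = "insert (\<lambda>n. real (y n)) C" and ?q = "q * B ^ T"
  let ?gt = "\<lambda>j n. of_bool (j * ?q \<le> y n) :: real"
  define X1 where "X1 = ?X \<union> ?gt ` {1..B-1}"
  have cardX1: "card X1 \<le> m"
  proof -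
    have "card X1 \<le> card ?X + card (?gt ` {1..B-1})"
      unfolding X1_def by (rule card_Un_le)
    also have "\<dots> \<le> Suc (card C) + (B - 1)"
      using card_image_le[of "{1..B-1}" ?gt] assms(3)
      by (intro add_mono) (auto simp: card_insert_if)
    finally show ?thesis using assms by simp
  qed
  have gm1: "computable D m (Suc L) X1"
  proof (rule computable_Suc[OF Suc.prems(1) assms(2) _ cardX1])
    show "finite X1" using assms by (simp add: X1_def)
    fix z assume "z \<in> X1"
    then consider "z \<in> ?X" | j where "z = ?gt j" unfolding X1_def by blast
    then show "\<exists>f\<in>aspan D ?X. \<exists>g\<in>aspan D ?X. \<forall>n\<in>D. z n = (if g n \<ge> 0 then f n else 0)"
    proof cases
      case 1
      then show ?thesis by (intro carry_gate aspan.base)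
    next
      case 2
      have "(\<lambda>n. real (y n) - real (j * ?q)) \<in> aspan D ?X"
        by (rule aspan_diff[OF aspan_insertI aspan.const])
      moreover have "\<forall>n\<in>D. z n = (if real (y n) - real (j * ?q) \<ge> 0 then 1 else 0)"
        using 2 by (simp del: of_nat_mult)
      ultimately show ?thesis by (rule gateI[OF aspan.const[of 1]])
    qed
  qed
  have "(\<lambda>n. \<Sum>j\<in>{1..B-1}. ?gt j n) \<in> aspan D X1"
    by (rule aspan_sum) (auto simp: X1_def intro: aspan.base)
  then have "(\<lambda>n. real (y n) - real ?q * (\<Sum>j\<in>{1..B-1}. ?gt j n)) \<in> aspan D X1"
    by (intro aspan_diff aspan.scale) (auto simp: X1_def intro: aspan.base)
  then have "(\<lambda>n. real (y n mod ?q)) \<in> aspan D X1"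
    by (rule aspan.cong) (use Suc.prems(2) mod_via_leading_digit[of _ ?q B] in \<open>simp add: ac_simps\<close>)
  then have "insert (\<lambda>n. real (y n mod ?q)) C \<subseteq> aspan D X1"
    by (auto simp: X1_def intro: aspan.base)
  from computable_aspan[OF gm1 this]
  have "computable D m (Suc L + T) (insert (\<lambda>n. real (y n mod ?q mod q)) C)"
  proof (rule Suc.IH)
    fix n assume "n \<in> D"
    then have "?q > 0" using Suc.prems(2)[of n] by (cases "?q = 0") auto
    then show "y n mod ?q < ?q" by simp
  qed
  then show ?case by (simp add: mod_mod_cancel)
qed

section \<open>Executing steps\<close>

text \<open>A step \<open>(d, a)\<close> moves the cursor \<open>d\<close> positions to the right and adds \<open>a\<close> to the entry
  there; \<open>exec ss p\<close> is the resulting entry at distance \<open>p\<close> from the initial cursor.\<close>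

primrec exec :: "(nat \<times> int) list \<Rightarrow> int \<Rightarrow> int" where
  "exec [] p = 0"
| "exec (s # ss) p = (if p = int (fst s) then snd s else 0) + exec ss (p - int (fst s))"

text \<open>Two digits in base \<open>Z\<close> per step: the jump, then the amount shifted by
  \<open>V\<close>. The first step occupies the leading digits, which are the ones removed
  first.\<close>

primrec code :: "nat \<Rightarrow> nat \<Rightarrow> (nat \<times> int) list \<Rightarrow> nat" where
  "code V Z [] = 0"
| "code V Z (s # ss) = (fst s * Z + nat (snd s + int V)) * Z ^ (2 * length ss) + code V Z ss"

text \<open>The lower bound keeps \<open>nat\<close> from truncating a negative number, so that the
  amount can be recovered from its digit.\<close>

definition codable :: "nat \<Rightarrow> nat \<Rightarrow> (nat \<times> int) list \<Rightarrow> bool" where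
  "codable V Z ss \<longleftrightarrow> (\<forall>s\<in>set ss. fst s < Z \<and> 0 \<le> snd s + int V \<and> nat (snd s + int V) < Z)"

lemma digits_less:
  fixes d a q Z y :: nat
  assumes "d < Z" "a < q" "y < z"
  shows "(d * q + a) * z + y < Z * q * z"
proof -
  have "d * q + a + 1 \<le> (d + 1) * q" using assms by simp
  also have "\<dots> \<le> Z * q" using assms by (intro mult_right_mono) auto
  finally have "(d * q + a + 1) * z \<le> Z * q * z" by (rule mult_right_mono) simp
  then show ?thesis using assms by (simp add: algebra_simps)
qed

lemma code_less:
  assumes "codable V Z ss"
  shows "code V Z ss < Z ^ (2 * length ss)"
  using assms
proof (induction ss)
  case (Cons s ss)
  have "(fst s * Z + nat (snd s + int V)) * Z ^ (2 * length ss) + code V Z ss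
      < Z * Z * Z ^ (2 * length ss)"
    using Cons by (intro digits_less) (auto simp: codable_def)
  then show ?case by (simp add: ac_simps)
qed simp

text \<open>One round per step: \<open>T\<close> layers split off the jump, \<open>T\<close> layers
  split off the amount, and one layer adds the amount if the cursor stands at the target. The
  function \<open>p\<close> holds the distance still to go and \<open>out\<close> the value
  accumulated so far.\<close>

lemma decode_steps:
  fixes ss :: "nat \<Rightarrow> (nat \<times> int) list"
  assumes "computable D m L {p, out, \<lambda>n. real (code V (B ^ T) (ss n))}"
    and D: "finite D" and B: "B \<ge> 1" and m: "B + 3 \<le> m" "5 \<le> m"
    and "\<And>n. n \<in> D \<Longrightarrow> length (ss n) = k \<and> codable V (B ^ T) (ss n)"
    and "\<And>n. n \<in> D \<Longrightarrow> p n = real_of_int (\<pi> n)"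
  shows "computable D m (L + k * (2 * T + 1)) {\<lambda>n. out n + real_of_int (exec (ss n) (\<pi> n))}"
  using assms(1,6,7)
proof (induction k arbitrary: L p out ss \<pi>)
  case 0
  have "(\<lambda>n. out n + real_of_int (exec (ss n) (\<pi> n))) \<in>
      aspan D {p, out, \<lambda>n. real (code V (B ^ T) (ss n))}"
    by (rule aspan.cong[of out]) (use 0 in \<open>auto intro: aspan.base\<close>)
  then show ?case using computable_aspan[OF 0(1)] by simp
next
  case (Suc k)
  define Z where "Z = B ^ T"
  have Z: "Z \<ge> 1" using B by (simp add: Z_def)
  define z where "z = Z ^ (2 * k)"
  have z: "z \<ge> 1" using Z by (simp add: z_def)
  define y d a y2 where "y n = code V Z (ss n)" and "d n = fst (hd (ss n))"
    and "a n = nat (snd (hd (ss n)) + int V)" and "y2 n = code V Z (tl (ss n))" for n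
  define y1 where "y1 n = y n mod (Z * z)" for n
  have fact: "y n < Z * z * Z \<and> y n = (d n * Z + a n) * z + y2 n \<and> y1 n = a n * z + y2 n
      \<and> y1 n < z * Z \<and> y1 n mod z = y2 n
      \<and> a n = snd (hd (ss n)) + int V \<and> length (tl (ss n)) = k \<and> codable V Z (tl (ss n))
      \<and> exec (ss n) (\<pi> n) = (if \<pi> n = int (d n) then int (a n) - int V else 0)
          + exec (tl (ss n)) (\<pi> n - int (d n))"
    if n: "n \<in> D" for n
  proof -
    obtain s t where st: "ss n = s # t" "length t = k" "codable V Z (s # t)"
      using Suc.prems(2)[OF n] by (auto simp: Z_def length_Suc_conv)
    then have *: "d n < Z" "a n < Z" "int (a n) = snd s + int V" "codable V Z t"
      by (auto simp: d_def a_def codable_def)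
    have "y2 n < z" using code_less[OF *(4)] st by (simp add: y2_def z_def)
    moreover have y: "y n = (d n * Z + a n) * z + y2 n"
      using st by (simp add: y_def d_def a_def y2_def z_def)
    moreover have less: "a n * z + y2 n < Z * z"
      using digits_less[of 0 1 "a n" Z "y2 n" z] * \<open>y2 n < z\<close> by simp
    moreover have "y n = d n * (Z * z) + (a n * z + y2 n)" using y by (simp add: algebra_simps)
    then have y1: "y1 n = a n * z + y2 n"
      using less by (simp only: y1_def mod_mult_self3 mod_less)
    moreover have "y1 n < z * Z" "y1 n mod z = y2 n"
      using less \<open>y2 n < z\<close> by (simp_all add: y1 ac_simps)
    moreover have "y n < Z * z * Z"
      using digits_less[OF *(1,2) \<open>y2 n < z\<close>] y by (simp add: ac_simps)
    ultimately show ?thesis using y * st by (auto simp: d_def)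
  qed
  have mod_y1: "y1 n mod z = y2 n" if "n \<in> D" for n using fact[OF that] by blast
  have lt: "y n < Z * z * B ^ T" "y1 n < z * B ^ T" if "n \<in> D" for n
    using fact[OF that] unfolding Z_def by blast+
  have card3: "card {f, g, h} \<le> 3" for f g h :: "nat \<Rightarrow> real" by (simp add: card_insert_if)
  define rd where "rd n = real (d n)" for n
  define p' where "p' n = p n - rd n" for n
  let ?y = "\<lambda>n. real (y n)" and ?y1 = "\<lambda>n. real (y1 n)" and ?y2 = "\<lambda>n. real (y2 n)"
  \<comment> \<open>The code is carried beside the copy that is being reduced, since the digit is
    their difference divided by \<open>Z * z\<close>. The three carried functions explain the width
    \<open>B + 3\<close>.\<close>
  have "computable D m L (insert ?y {p, out, ?y})"
    using Suc.prems(1) by (simp add: y_def Z_def insert_commute)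
  then have gm1: "computable D m (L + T) (insert ?y1 {p, out, ?y})"
    unfolding y1_def
    by (rule extract_mod[OF _ D _ _ B lt(1)]) (use m(1) card3[of p out ?y] in auto)
  have "(\<lambda>n. (1 / real (Z * z)) * (?y n - ?y1 n)) \<in> aspan D (insert ?y1 {p, out, ?y})"
    by (intro aspan.scale aspan_diff aspan.base) auto
  then have rd: "rd \<in> aspan D (insert ?y1 {p, out, ?y})"
    by (rule aspan.cong) (use fact Z z in \<open>simp add: rd_def field_simps\<close>)
  have "p' \<in> aspan D (insert ?y1 {p, out, ?y})"
    unfolding p'_def by (rule aspan_diff[OF _ rd]) (simp add: aspan.base)
  then have "insert ?y1 {p', out, ?y1} \<subseteq> aspan D (insert ?y1 {p, out, ?y})"
    by (auto intro: aspan.base)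
  from computable_aspan[OF gm1 this]
  have "computable D m (L + T + T) (insert (\<lambda>n. real (y1 n mod z)) {p', out, ?y1})"
    by (rule extract_mod[OF _ D _ _ B lt(2)]) (use m(1) card3[of p' out ?y1] in auto)
  moreover have "?y2 \<in> aspan D (insert (\<lambda>n. real (y1 n mod z)) {p', out, ?y1})"
    by (rule aspan.cong[OF aspan_insertI]) (simp only: mod_y1)
  then have "{?y2, p', out, ?y1} \<subseteq> aspan D (insert (\<lambda>n. real (y1 n mod z)) {p', out, ?y1})"
    by (auto intro: aspan.base)
  ultimately have gm2: "computable D m (L + T + T) {?y2, p', out, ?y1}" by (rule computable_aspan)
  define amt where "amt n = real (a n) - real V" for n
  have "(\<lambda>n. (1 / real z) * (?y1 n - ?y2 n)) \<in> aspan D {?y2, p', out, ?y1}"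
    by (intro aspan.scale aspan_diff aspan.base) auto
  then have "(\<lambda>n. real (a n)) \<in> aspan D {?y2, p', out, ?y1}"
    by (rule aspan.cong) (use fact z in \<open>simp add: field_simps\<close>)
  then have amt: "amt \<in> aspan D {?y2, p', out, ?y1}"
    unfolding amt_def by (rule aspan_diff[OF _ aspan.const])
  have p1: "(\<lambda>n. p' n - 1) \<in> aspan D {?y2, p', out, ?y1}"
    by (rule aspan_diff[OF _ aspan.const]) (simp add: aspan.base)
  \<comment> \<open>As \<open>p' n\<close> is an integer on \<open>D\<close>, the gates for
    \<open>p' n \<ge> 0\<close> and \<open>p' n \<ge> 1\<close> differ exactly where
    \<open>p' n = 0\<close>, so \<open>g0 - g1\<close> is the amount applied at the target.\<close>
  define g0 g1 where "g0 n = (if p' n \<ge> 0 then amt n else 0)"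
    and "g1 n = (if p' n - 1 \<ge> 0 then amt n else 0)" for n
  define X where "X = {p', out, ?y2, g0, g1}"
  have gm3: "computable D m (Suc (L + T + T)) X"
  proof (rule computable_Suc[OF gm2 D])
    show "finite X" by (simp add: X_def)
    have "card X \<le> 5" by (simp add: X_def card_insert_if)
    then show "card X \<le> m" using m by simp
    fix f assume "f \<in> X"
    then consider "f \<in> {?y2, p', out, ?y1}" | "f = g0" | "f = g1" by (auto simp: X_def)
    then show "\<exists>f'\<in>aspan D {?y2, p', out, ?y1}. \<exists>g\<in>aspan D {?y2, p', out, ?y1}.
        \<forall>n\<in>D. f n = (if g n \<ge> 0 then f' n else 0)"
    proof cases
      case 1
      then show ?thesis by (intro carry_gate aspan.base)
    next
      case 2
      have "p' \<in> aspan D {?y2, p', out, ?y1}" by (simp add: aspan.base)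
      then show ?thesis using 2 by (intro gateI[OF amt]) (auto simp: g0_def)
    next
      case 3
      then show ?thesis by (intro gateI[OF amt p1]) (auto simp: g1_def)
    qed
  qed
  define out' where "out' n = (out n + g0 n) - g1 n" for n
  have "out' \<in> aspan D X"
    unfolding out'_def by (intro aspan_diff aspan.add aspan.base) (simp_all add: X_def)
  then have "{p', out', ?y2} \<subseteq> aspan D X" by (auto simp: X_def intro: aspan.base)
  from computable_aspan[OF gm3 this]
  have "computable D m (Suc (L + T + T) + k * (2 * T + 1))
      {\<lambda>n. out' n + real_of_int (exec (tl (ss n)) (\<pi> n - int (d n)))}"
    unfolding y2_def Z_def
    by (rule Suc.IH) (use fact Suc.prems(3) in \<open>auto simp: Z_def p'_def rd_def\<close>)
  moreover have "(\<lambda>n. out n + real_of_int (exec (ss n) (\<pi> n))) \<in>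
      aspan D {\<lambda>n. out' n + real_of_int (exec (tl (ss n)) (\<pi> n - int (d n)))}"
  proof (rule aspan.cong[OF aspan_insertI])
    fix n assume n: "n \<in> D"
    have "p' n = real_of_int (\<pi> n - int (d n))"
      using Suc.prems(3)[OF n] by (simp add: p'_def rd_def)
    then have "g0 n - g1 n = (if \<pi> n = int (d n) then amt n else 0)"
      unfolding g0_def g1_def by auto
    then show "out' n + real_of_int (exec (tl (ss n)) (\<pi> n - int (d n))) =
        out n + real_of_int (exec (ss n) (\<pi> n))"
      using fact[OF n] by (simp add: out'_def amt_def)
  qed
  ultimately have "computable D m (Suc (L + T + T) + k * (2 * T + 1))
      {\<lambda>n. out n + real_of_int (exec (ss n) (\<pi> n))}"
    using computable_aspan by simp
  then show ?case by (simp add: algebra_simps)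
qed

section \<open>Step sequences that write a vector\<close>

lemma exec_append:
  "exec (s @ t) p = exec s p + exec t (p - int (sum_list (map fst s)))"
  by (induction s arbitrary: p) (simp_all add: algebra_simps)

lemma exec_stationary: "exec (map (Pair 0) as) p = (if p = 0 then sum_list as else 0)"
  by (induction as) auto

text \<open>Greedy: clipping \<open>v\<close> to the range from \<open>-V\<close> to
  \<open>V\<close> gives one summand and leaves a remainder of size at most \<open>c * V\<close> for
  the other \<open>c\<close>; zeros fill up the length.\<close>

lemma split_amount:
  fixes v :: int
  assumes "\<bar>v\<bar> \<le> int (c * V)"
  shows "\<exists>as. length as = c \<and> (\<forall>a\<in>set as. \<bar>a\<bar> \<le> int V) \<and> sum_list as = v"
  using assms
proof (induction c arbitrary: v)
  case (Suc c)
  define a where "a = max (- int V) (min (int V) v)"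
  have "int (Suc c * V) = int V + int (c * V)" "int (c * V) \<ge> 0" by simp_all
  then have "\<bar>v - a\<bar> \<le> int (c * V)" "\<bar>a\<bar> \<le> int V"
    using Suc.prems unfolding a_def by linarith+
  with Suc.IH[of "v - a"] obtain as where
    "length as = c" "\<forall>a\<in>set as. \<bar>a\<bar> \<le> int V" "sum_list as = v - a" by blast
  then show ?case using \<open>\<bar>a\<bar> \<le> int V\<close> by (intro exI[of _ "a # as"]) auto
qed simp

text \<open>Induction on \<open>l\<close>, where only positions with \<open>c = 0\<close> lie
  between the cursor and the end of the interval. A new position with nonzero \<open>c\<close> is
  reached by one jump, which is short because every multiple of \<open>V\<close> must be
  visited.\<close>

lemma steps_exist:
  fixes x :: "nat \<Rightarrow> int" and c :: "nat \<Rightarrow> nat"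
  assumes x: "\<And>n. \<bar>x n\<bar> \<le> int (c n * V)" and c: "\<And>n. V dvd n \<Longrightarrow> c n \<ge> 1" and V: "V \<ge> 1"
  shows "\<exists>s. length s = (\<Sum>i\<in>{b<..b+l}. c i) \<and> (\<forall>t\<in>set s. fst t \<le> V \<and> \<bar>snd t\<bar> \<le> int V)
    \<and> sum_list (map fst s) \<le> l
    \<and> (\<forall>i. sum_list (map fst s) < i \<and> i \<le> l \<longrightarrow> c (b + i) = 0)
    \<and> (\<forall>p. exec s (int p) = (if 0 < p \<and> p \<le> l then x (b + p) else 0))"
proof (induction l)
  case 0
  show ?case by (intro exI[of _ "[]"]) simp
next
  case (Suc l)
  then obtain s where s: "length s = (\<Sum>i\<in>{b<..b+l}. c i)"
    "\<forall>t\<in>set s. fst t \<le> V \<and> \<bar>snd t\<bar> \<le> int V" "sum_list (map fst s) \<le> l"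
    "\<And>i. sum_list (map fst s) < i \<Longrightarrow> i \<le> l \<Longrightarrow> c (b + i) = 0"
    "\<And>p. exec s (int p) = (if 0 < p \<and> p \<le> l then x (b + p) else 0)" by blast
  have "{b<..b + Suc l} = insert (b + Suc l) {b<..b+l}" by auto
  then have sum: "(\<Sum>i\<in>{b<..b + Suc l}. c i) = c (b + Suc l) + (\<Sum>i\<in>{b<..b+l}. c i)" by simp
  show ?case
  proof (cases "c (b + Suc l) = 0")
    case True
    then have "x (b + Suc l) = 0" using x[of "b + Suc l"] by simp
    then have "exec s (int p) = (if 0 < p \<and> p \<le> Suc l then x (b + p) else 0)" for p
      using s(5)[of p] by (auto simp: le_Suc_eq)
    moreover have "c (b + i) = 0" if "sum_list (map fst s) < i" "i \<le> Suc l" for i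
      using that s(4) True by (cases "i = Suc l") auto
    ultimately show ?thesis using s True sum by (intro exI[of _ s]) auto
  next
    case False
    define q where "q = Suc l - sum_list (map fst s)"
    have q: "sum_list (map fst s) + q = Suc l" using s(3) by (simp add: q_def)
    have "q \<le> V"
    proof (rule ccontr)
      assume "\<not> q \<le> V"
      \<comment> \<open>The largest multiple of \<open>V\<close> up to \<open>b + l\<close>; a jump
        longer than \<open>V\<close> would have skipped it although
        \<open>c i \<ge> 1\<close>.\<close>
      define i where "i = ((b + l) div V) * V"
      have "i \<le> b + l" "b + l < i + V"
        unfolding i_def using V mod_less_divisor[of V "b + l"] div_mult_mod_eq[of "b + l" V]
        by linarith+
      moreover from this have "sum_list (map fst s) < i - b" "b < i"
        using q \<open>\<not> q \<le> V\<close> by linarith+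
      ultimately have "c i = 0" using s(4)[of "i - b"] by simp
      then show False using c[of i] by (simp add: i_def)
    qed
    obtain as where as: "length as = c (b + Suc l)" "\<forall>a\<in>set as. \<bar>a\<bar> \<le> int V"
      "sum_list as = x (b + Suc l)" using split_amount[OF x] by blast
    with False obtain a1 as' where as': "as = a1 # as'" by (cases as) auto
    \<comment> \<open>Only the first step at the new position moves the cursor; the remaining ones
      add their amounts with jump 0.\<close>
    define t where "t = (q, a1) # map (Pair 0) as'"
    have t: "exec t p = (if p = int q then x (b + Suc l) else 0)" for p
      using as as' by (simp add: t_def exec_stationary)
    have fst0: "sum_list (map fst (map (Pair 0) as')) = (0::nat)" for as' :: "int list"
      by (induction as') auto
    have "exec (s @ t) (int p) = (if 0 < p \<and> p \<le> Suc l then x (b + p) else 0)" for p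
    proof -
      have "int p - int (sum_list (map fst s)) = int q \<longleftrightarrow> p = Suc l" using q by linarith
      then show ?thesis using s(5)[of p] by (auto simp: exec_append t le_Suc_eq)
    qed
    moreover have "sum_list (map fst (s @ t)) = Suc l" using q by (simp add: t_def fst0 del: map_map)
    moreover have "length (s @ t) = (\<Sum>i\<in>{b<..b + Suc l}. c i)"
      using s as as' sum by (simp add: t_def)
    moreover have "\<forall>u\<in>set (s @ t). fst u \<le> V \<and> \<bar>snd u\<bar> \<le> int V"
      using s as as' \<open>q \<le> V\<close> by (auto simp: t_def)
    ultimately show ?thesis by (intro exI[of _ "s @ t"]) simp
  qed
qed

section \<open>The network of an integer vector\<close>

text \<open>\<open>c n\<close> counts the steps spent at position \<open>n\<close>, and blocks are
  the level sets of the cumulative count divided by \<open>S\<close>. The first entry of a block may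
  need many steps and is therefore encoded directly; fewer than \<open>S\<close> steps remain to be
  decoded.\<close>

lemma sparse_vector_network:
  fixes x :: "nat \<Rightarrow> int" and c :: "nat \<Rightarrow> nat"
  assumes x: "\<And>n. \<bar>x n\<bar> \<le> int (c n * w ^ T)" and c: "\<And>n. w ^ T dvd n \<Longrightarrow> c n \<ge> 1"
    and pos: "w \<ge> 1" "S \<ge> 1" "T \<ge> 1"
    and sum: "(\<Sum>n=1..N. c n) \<le> 3 * H" and H: "H \<le> w\<^sup>2 * S\<^sup>2 * (T + 2)"
    and m: "9 * w + 4 \<le> m"
  shows "\<exists>g\<in>NN 1 1 (2 * m) (4 * S * (T + 2)). \<forall>n\<in>{1..N}. g (\<lambda>_. real n) 0 = real_of_int (x n)"
proof -
  define D where "D = {1..N}"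
  have D: "finite D" by (simp add: D_def)
  define V where "V = w ^ T"
  have V: "V \<ge> 1" using pos by (simp add: V_def)
  define cum where "cum n = (\<Sum>i=1..n. c i)" for n
  have cum_split: "cum n = cum b + (\<Sum>i\<in>{b<..n}. c i)" if "b \<le> n" for b n
  proof -
    have "{1..n} = {1..b} \<union> {b<..n}" using that by auto
    moreover have "sum c ({1..b} \<union> {b<..n}) = sum c {1..b} + sum c {b<..n}"
      by (rule sum.union_disjoint) auto
    ultimately show ?thesis unfolding cum_def by simp
  qed
  define r where "r n = cum n div S" for n
  have mono: "mono r"
    by (rule monoI) (auto simp: r_def cum_split intro: div_le_mono)
  define st where "st \<rho> = Min {n\<in>D. r n = \<rho>}" for \<rho>
  define en where "en \<rho> = Max {n\<in>D. r n = \<rho>}" for \<rho>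
  have block: "st (r n) \<in> D \<and> r (st (r n)) = r n \<and> st (r n) \<le> n \<and>
      n \<le> en (r n) \<and> r (en (r n)) = r n" if "n \<in> D" for n
  proof -
    have ne: "finite {n'\<in>D. r n' = r n}" "{n'\<in>D. r n' = r n} \<noteq> {}" using D that by auto
    show ?thesis
      using Min_in[OF ne] Max_in[OF ne] Min_le[OF ne(1), of n] Max_ge[OF ne(1), of n] that
      by (auto simp: st_def en_def)
  qed
  \<comment> \<open>Jumps are at most \<open>V\<close> and shifted amounts at most
    \<open>2 * V\<close>; base \<open>3 * w\<close> instead of \<open>w\<close> makes room for both,
    as \<open>T \<ge> 1\<close>.\<close>
  define Z where "Z = (3 * w) ^ T"
  have VZ: "V + V < Z"
  proof -
    have "(3::nat) ^ 1 \<le> 3 ^ T" by (rule power_increasing) (use pos in auto)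
    then have "3 * V \<le> Z" by (simp add: Z_def V_def power_mult_distrib)
    then show ?thesis using V by simp
  qed
  have "\<exists>s. \<rho> \<in> r ` D \<longrightarrow> length s = S - 1 \<and> codable V Z s \<and>
      (\<forall>p. exec s (int p) = (if 0 < p \<and> st \<rho> + p \<le> en \<rho> then x (st \<rho> + p) else 0))" for \<rho>
  proof (cases "\<rho> \<in> r ` D")
    case True
    then obtain n where n: "n \<in> D" "\<rho> = r n" by blast
    define l where "l = en \<rho> - st \<rho>"
    have l: "st \<rho> + l = en \<rho>" using block[OF n(1)] n(2) by (simp add: l_def)
    obtain s where s: "length s = (\<Sum>i\<in>{st \<rho><..st \<rho> + l}. c i)"
      "\<forall>t\<in>set s. fst t \<le> V \<and> \<bar>snd t\<bar> \<le> int V"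
      "\<And>p. exec s (int p) = (if 0 < p \<and> p \<le> l then x (st \<rho> + p) else 0)"
      using steps_exist[of x c V "st \<rho>" l] x c V unfolding V_def by blast
    have "cum (en \<rho>) = cum (st \<rho>) + length s"
      using cum_split[of "st \<rho>" "en \<rho>"] l s(1) by simp
    moreover have "cum (en \<rho>) div S = cum (st \<rho>) div S"
      using block[OF n(1)] n(2) by (simp add: r_def)
    \<comment> \<open>With \<open>S\<close> or more steps after its first position, the block would
      not have a constant quotient \<open>cum n div S\<close>.\<close>
    ultimately have "length s < S"
      using pos div_le_mono[of "cum (st \<rho>) + S" "cum (en \<rho>)" S] by (cases "S \<le> length s") auto
    \<comment> \<open>Null steps give all blocks the same number of steps, because one network
      executes them all.\<close>
    define s' where "s' = s @ map (Pair 0) (replicate (S - 1 - length s) 0)"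
    have "exec s' p = exec s p" for p
      by (simp only: s'_def exec_append exec_stationary sum_list_replicate) simp
    moreover have "length s' = S - 1" using \<open>length s < S\<close> by (simp add: s'_def)
    moreover have "codable V Z s'"
      using s(2) VZ V by (force simp: codable_def s'_def)
    ultimately show ?thesis using s(3) l by (intro exI[of _ s']) auto
  qed simp
  then obtain ss where ss: "\<And>\<rho>. \<rho> \<in> r ` D \<Longrightarrow> length (ss \<rho>) = S - 1 \<and> codable V Z (ss \<rho>) \<and>
      (\<forall>p. exec (ss \<rho>) (int p) = (if 0 < p \<and> st \<rho> + p \<le> en \<rho> then x (st \<rho> + p) else 0))"
    by metis
  \<comment> \<open>Three encodings of \<open>2 * P\<close> layers take at most
    \<open>2 * S * (T + 2)\<close> layers, half of the depth. With groups of size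
    \<open>9 * w\<close> they admit \<open>81 * w\<^sup>2 * P\<close> thresholds, enough for the at
    most \<open>3 * w\<^sup>2 * S * (T + 2)\<close> that occur.\<close>
  define P where "P = S * (T + 2) div 3"
  have P: "S * (T + 2) \<le> 27 * P" "3 * P \<le> S * (T + 2)"
  proof -
    have "1 * 3 \<le> S * (T + 2)" using pos by (intro mult_le_mono) auto
    then show "S * (T + 2) \<le> 27 * P" "3 * P \<le> S * (T + 2)" unfolding P_def by linarith+
  qed
  have bound: "r n \<le> P * (9 * w * (9 * w))" if "n \<in> D" for n
  proof -
    have "cum n \<le> cum N" using cum_split[of n N] that by (simp add: D_def)
    also have "\<dots> \<le> 3 * (w\<^sup>2 * S\<^sup>2 * (T + 2))" using sum H unfolding cum_def by linarith
    also have "\<dots> = 3 * w\<^sup>2 * (S * (T + 2)) * S" by (simp add: power2_eq_square algebra_simps)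
    finally have "r n \<le> 3 * w\<^sup>2 * (S * (T + 2)) * S div S" unfolding r_def by (rule div_le_mono)
    also have "\<dots> = 3 * w\<^sup>2 * (S * (T + 2))" using pos by simp
    also have "\<dots> \<le> 3 * w\<^sup>2 * (27 * P)" using P by (intro mult_left_mono) auto
    finally show ?thesis by (simp add: power2_eq_square ac_simps)
  qed
  define h1 h2 h3 where "h1 n = real (st (r n))" and "h2 n = real_of_int (x (st (r n)))"
    and "h3 n = real (code V Z (ss (r n)))" for n
  \<comment> \<open>At most three functions are carried along, so a stage needs
    \<open>9 * w + 4\<close> gates.\<close>
  have enc: "computable D m (L + 2 * P) (insert (\<lambda>n. h (r n)) C)"
    if "computable D m L C" "finite C" "card C \<le> 3" "real \<in> C" for L C h
    by (rule encode_monotone[OF that(1) D that(2,4) mono _ _ bound]) (use that m pos in auto)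
  have "computable D m (0 + 2 * P) {h1, real}"
    unfolding h1_def by (rule enc[OF computable_0]) auto
  then have "computable D m (0 + 2 * P + 2 * P) {h2, h1, real}"
    unfolding h2_def by (rule enc) (auto simp: card_insert_if)
  then have gm1: "computable D m (0 + 2 * P + 2 * P + 2 * P) {h3, h2, h1, real}"
    unfolding h3_def by (rule enc) (auto simp: card_insert_if)
  define p where "p n = real n - h1 n" for n
  \<comment> \<open>On \<open>D\<close> the distance \<open>p n\<close> is nonnegative, so this gate
    opens only at the first position of a block, where the decoded steps contribute 0.\<close>
  define out where "out n = (if - p n \<ge> 0 then h2 n else 0)" for n
  let ?X = "{h3, h2, h1, real}"
  have p: "p \<in> aspan D ?X" unfolding p_def by (rule aspan_diff; rule aspan.base) auto
  have gm2: "computable D m (Suc (0 + 2 * P + 2 * P + 2 * P)) {p, out, h3}"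
  proof (rule computable_Suc[OF gm1 D])
    have "card {p, out, h3} \<le> 3" by (simp add: card_insert_if)
    then show "card {p, out, h3} \<le> m" using m by simp
    fix f assume "f \<in> {p, out, h3}"
    then consider "f = p \<or> f = h3" | "f = out" by blast
    then show "\<exists>f'\<in>aspan D ?X. \<exists>g\<in>aspan D ?X. \<forall>n\<in>D. f n = (if g n \<ge> 0 then f' n else 0)"
    proof cases
      case 1
      then show ?thesis using p by (intro carry_gate) (auto intro: aspan.base)
    next
      case 2
      have "(\<lambda>n. - p n) \<in> aspan D ?X" using aspan.scale[OF p, of "-1"] by simp
      moreover have "h2 \<in> aspan D ?X" by (rule aspan.base) simp
      ultimately show ?thesis using 2 by (intro gateI[of h2 _ _ "\<lambda>n. - p n"]) (auto simp: out_def)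
    qed
  qed simp
  let ?\<pi> = "\<lambda>n. int n - int (st (r n))"
  let ?L = "Suc (0 + 2 * P + 2 * P + 2 * P) + (S - 1) * (2 * T + 1)"
  define res where "res n = out n + real_of_int (exec (ss (r n)) (?\<pi> n))" for n
  have gm3: "computable D m ?L {res}"
    unfolding res_def
    by (rule decode_steps[where V=V and B="3 * w" and p=p])
       (use gm2 D pos m ss in \<open>auto simp: Z_def h3_def[abs_def] p_def h1_def\<close>)
  have depth: "?L \<le> 4 * S * (T + 2)"
  proof -
    obtain S' where "S = Suc S'" using pos by (cases S) auto
    then show ?thesis using P(2) by (simp add: algebra_simps)
  qed
  have "computable D m (4 * S * (T + 2)) {res}"
    by (rule computable_pad[OF gm3 D _ _ depth]) (use m in simp_all)
  then obtain F where F: "reaches D (2 * m) (4 * S * (T + 2)) F" "res \<in> aspan D (set F)"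
    unfolding computable_def by blast
  have "res n = real_of_int (x n)" if "n \<in> D" for n
  proof -
    have *: "st (r n) \<le> n" "n \<le> en (r n)" using block[OF that] by auto
    have "?\<pi> n = int (n - st (r n))" using * by simp
    moreover have "exec (ss (r n)) (int (n - st (r n))) = (if st (r n) < n then x n else 0)"
      using ss[of "r n"] that * by (simp del: of_nat_diff)
    ultimately have "exec (ss (r n)) (?\<pi> n) = (if st (r n) < n then x n else 0)" by (simp only:)
    then show ?thesis using * by (auto simp: res_def out_def p_def h1_def h2_def)
  qed
  then show ?thesis using reaches_output[OF F] by (simp add: D_def)
qed

lemma sum_indicator_dvd:
  fixes N V :: nat
  assumes "V \<ge> 1"
  shows "(\<Sum>n=1..N. if V dvd n then 1 else (0::nat)) = N div V"
proof (induction N)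
  case (Suc N)
  then show ?case by (simp add: div_Suc mod_eq_0_iff_dvd)
qed simp

lemma NN_mono:
  assumes "W \<le> W'"
  shows "NN d k W L \<subseteq> NN d k W' L"
  using assms unfolding NN_def by (fastforce intro: le_trans)

text \<open>Position \<open>n\<close> is visited \<open>\<lceil>\<bar>x n\<bar> / w ^ T\<rceil>\<close> times, and once more if \<open>w ^ T\<close> divides \<open>n\<close>,
  which keeps the distance between consecutive visits at most \<open>w ^ T\<close>.\<close>

lemma integer_vector_network:
  fixes x :: "nat \<Rightarrow> int"
  assumes pos: "w \<ge> 1" "S \<ge> 1" "T \<ge> 1"
    and sum: "(\<Sum>n=1..N. (nat \<bar>x n\<bar> + (w ^ T - 1)) div w ^ T) \<le> 2 * H" "N div w ^ T \<le> H"
    and H: "H \<le> w\<^sup>2 * S\<^sup>2 * (T + 2)" and m: "18 * w + 8 \<le> W"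
  shows "\<exists>g\<in>NN 1 1 W (4 * S * (T + 2)). \<forall>n\<in>{1..N}. g (\<lambda>_. real n) 0 = real_of_int (x n)"
proof -
  let ?V = "w ^ T"
  have V: "?V \<ge> 1" using pos by simp
  define c where "c n = (nat \<bar>x n\<bar> + (?V - 1)) div ?V + (if ?V dvd n then 1 else 0)" for n
  have "\<bar>x n\<bar> \<le> int (c n * ?V)" for n
  proof -
    let ?a = "nat \<bar>x n\<bar>" and ?q = "(nat \<bar>x n\<bar> + (?V - 1)) div ?V"
    have "?a + (?V - 1) < (?q + 1) * ?V"
      using V mod_less_divisor[of ?V "?a + (?V - 1)"] div_mult_mod_eq[of "?a + (?V - 1)" ?V]
      unfolding distrib_right by linarith
    then have "?a \<le> ?q * ?V" using V unfolding distrib_right by linarith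
    also have "\<dots> \<le> c n * ?V" by (intro mult_right_mono) (simp_all add: c_def)
    finally have "int ?a \<le> int (c n * ?V)" by (simp only: of_nat_le_iff)
    then show ?thesis by simp
  qed
  \<comment> \<open>The sizes of the entries account for \<open>2 * H\<close> visits, the multiples
    of \<open>w ^ T\<close> for another \<open>H\<close>.\<close>
  moreover have "(\<Sum>n=1..N. c n) \<le> 3 * H"
    using sum sum_indicator_dvd[OF V, of N] by (simp add: c_def sum.distrib)
  ultimately have "\<exists>g\<in>NN 1 1 (2 * (9 * w + 4)) (4 * S * (T + 2)).
      \<forall>n\<in>{1..N}. g (\<lambda>_. real n) 0 = real_of_int (x n)"
    by (intro sparse_vector_network[OF _ _ pos _ H]) (auto simp: c_def)
  moreover have "NN 1 1 (2 * (9 * w + 4)) (4 * S * (T + 2)) \<subseteq> NN 1 1 W (4 * S * (T + 2))"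
    using m by (intro NN_mono) simp
  ultimately show ?thesis by blast
qed

section \<open>Parameters in the two regimes\<close>

lemma ceiling_power_bound:
  assumes "a > 0" "b > 0" "T \<ge> 1" "\<lceil>(a / b) powr (1 / real T)\<rceil> \<le> int w"
  shows "a \<le> b * real w ^ T"
proof -
  have le: "(a / b) powr (1 / real T) \<le> real w" using assms(4) by linarith
  have "a / b = ((a / b) powr (1 / real T)) ^ T"
    using assms by (simp add: powr_realpow[symmetric] powr_powr)
  also have "\<dots> \<le> real w ^ T" using le by (intro power_mono) auto
  finally show ?thesis using assms by (simp add: field_simps)
qed

text \<open>Here \<open>H = M\<close>: a rounded-up quotient of a natural number is at most that
  number, so the entries need at most \<open>M\<close> visits. Squaring the bound on
  \<open>w\<close> gives the capacity condition.\<close>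

lemma first_regime_network:
  fixes N M S T w :: nat and x :: "nat \<Rightarrow> int"
  assumes pos: "M \<ge> 1" "S \<ge> 1" "T \<ge> 1" "w \<ge> 1"
    and sum: "(\<Sum>n=1..N. \<bar>x n\<bar>) \<le> int M"
    and w1: "sqrt (real M) / (real S * sqrt (real T + 2)) \<le> real w"
    and NM: "N \<le> M * w ^ T" and W: "18 * w + 8 \<le> W"
  shows "\<exists>g\<in>NN 1 1 W (4 * S * (T + 2)). \<forall>n\<in>{1..N}. g (\<lambda>_. real n) 0 = real_of_int (x n)"
proof (rule integer_vector_network[OF \<open>w \<ge> 1\<close> \<open>S \<ge> 1\<close> \<open>T \<ge> 1\<close>, where H = M, OF _ _ _ W])
  have V: "w ^ T \<ge> 1" using pos by simp
  have "(a + (V - 1)) div V \<le> a" if "V \<ge> 1" for a V :: nat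
  proof (cases "a = 0")
    case False
    then have "a + (V - 1) < a * V + V"
      using mult_le_mono2[of 1 V a] that by linarith
    then show ?thesis using that by (simp add: div_less_iff_less_mult less_Suc_eq_le[symmetric])
  qed (use that in simp)
  then have "(\<Sum>n=1..N. (nat \<bar>x n\<bar> + (w ^ T - 1)) div w ^ T) \<le> (\<Sum>n=1..N. nat \<bar>x n\<bar>)"
    using V by (intro sum_mono) blast
  also have "int \<dots> = (\<Sum>n=1..N. \<bar>x n\<bar>)" by simp
  then have "(\<Sum>n=1..N. nat \<bar>x n\<bar>) \<le> 2 * M" using sum by linarith
  finally show "(\<Sum>n=1..N. (nat \<bar>x n\<bar> + (w ^ T - 1)) div w ^ T) \<le> 2 * M" .
  show "N div w ^ T \<le> M" using div_le_mono[OF NM, of "w ^ T"] pos by simp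
  have "sqrt (real M) \<le> real w * (real S * sqrt (real T + 2))"
    using w1 pos by (simp add: divide_le_eq)
  then have "(sqrt (real M))\<^sup>2 \<le> (real w * (real S * sqrt (real T + 2)))\<^sup>2"
    by (rule power_mono) simp
  then have "real M \<le> real (w\<^sup>2 * S\<^sup>2 * (T + 2))" by (simp add: power_mult_distrib algebra_simps)
  then show "M \<le> w\<^sup>2 * S\<^sup>2 * (T + 2)" by (simp only: of_nat_le_iff)
qed

text \<open>Here \<open>H = N\<close>: rounding up costs at most one visit per position, and the
  integer quotients sum to at most \<open>N\<close> because
  \<open>M \<le> N * w ^ T\<close>.\<close>

lemma second_regime_network:
  fixes N M S T w S' :: nat and x :: "nat \<Rightarrow> int"
  assumes pos: "N \<ge> 1" "M \<ge> 1" "S \<ge> 1" "T \<ge> 1" "w \<ge> 1" "S' \<ge> 1"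
    and sum: "(\<Sum>n=1..N. \<bar>x n\<bar>) \<le> int M"
    and w1: "real M / (real S * sqrt (real N * (real T + 2))) \<le> real w"
    and S': "real S * real N / real M \<le> real S'"
    and MN: "M \<le> N * w ^ T" and W: "18 * w + 8 \<le> W"
  shows "\<exists>g\<in>NN 1 1 W (4 * S' * (T + 2)). \<forall>n\<in>{1..N}. g (\<lambda>_. real n) 0 = real_of_int (x n)"
proof (rule integer_vector_network[OF \<open>w \<ge> 1\<close> \<open>S' \<ge> 1\<close> \<open>T \<ge> 1\<close>, where H = N, OF _ _ _ W])
  have V: "w ^ T \<ge> 1" using pos by simp
  have "(a + (V - 1)) div V \<le> a div V + 1" if "V \<ge> 1" for a V :: nat
    using div_le_mono[of "a + (V - 1)" "a + V" V] that by simp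
  then have "(\<Sum>n=1..N. (nat \<bar>x n\<bar> + (w ^ T - 1)) div w ^ T) \<le> (\<Sum>n=1..N. nat \<bar>x n\<bar> div w ^ T + 1)"
    using V by (intro sum_mono) blast
  also have "\<dots> = (\<Sum>n=1..N. nat \<bar>x n\<bar> div w ^ T) + N" by (simp only: sum.distrib) simp
  also have "(\<Sum>n=1..N. nat \<bar>x n\<bar> div w ^ T) \<le> N"
  proof -
    have "(\<Sum>n=1..N. nat \<bar>x n\<bar> div w ^ T) * w ^ T \<le> (\<Sum>n=1..N. nat \<bar>x n\<bar>)"
      unfolding sum_distrib_right by (intro sum_mono) simp
    also have "int \<dots> = (\<Sum>n=1..N. \<bar>x n\<bar>)" by simp
    then have "(\<Sum>n=1..N. nat \<bar>x n\<bar>) \<le> N * w ^ T" using sum MN by linarith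
    finally show ?thesis using pos by simp
  qed
  finally show "(\<Sum>n=1..N. (nat \<bar>x n\<bar> + (w ^ T - 1)) div w ^ T) \<le> 2 * N" by simp
  show "N div w ^ T \<le> N" by simp
  have "real M \<le> real w * (real S * sqrt (real N * (real T + 2)))"
    using w1 pos by (simp add: divide_le_eq)
  then have "(real M)\<^sup>2 \<le> (real w * (real S * sqrt (real N * (real T + 2))))\<^sup>2"
    by (rule power_mono) simp
  then have M2: "(real M)\<^sup>2 \<le> (real w)\<^sup>2 * (real S)\<^sup>2 * real N * (real T + 2)"
    by (simp add: power_mult_distrib mult.assoc)
  have SN: "real S * real N \<le> real S' * real M" using S' pos by (simp add: divide_le_eq)
  \<comment> \<open>The extra factor \<open>N\<close> completes the square of \<open>S * N\<close>,
    which is at most \<open>S' * M\<close>; then the square of \<open>M\<close> cancels.\<close>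
  have "real N * (real M)\<^sup>2 \<le> real N * ((real w)\<^sup>2 * (real S)\<^sup>2 * real N * (real T + 2))"
    using M2 by (rule mult_left_mono) simp
  also have "\<dots> = (real w)\<^sup>2 * (real T + 2) * (real S * real N)\<^sup>2"
    by (simp add: power2_eq_square)
  also have "\<dots> \<le> (real w)\<^sup>2 * (real T + 2) * (real S' * real M)\<^sup>2"
    using SN by (intro mult_left_mono power_mono) auto
  also have "\<dots> = (real w)\<^sup>2 * (real S')\<^sup>2 * (real T + 2) * (real M)\<^sup>2"
    by (simp add: power_mult_distrib)
  finally have "real N \<le> (real w)\<^sup>2 * (real S')\<^sup>2 * (real T + 2)"
    using pos by (simp add: mult_le_cancel_right)
  then have "real N \<le> real (w\<^sup>2 * S'\<^sup>2 * (T + 2))" by (simp add: algebra_simps)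
  then show "N \<le> w\<^sup>2 * S'\<^sup>2 * (T + 2)" by (simp only: of_nat_le_iff)
qed

theorem mainTheorem7:
  fixes N M S T :: nat and x :: "nat \<Rightarrow> int"
  assumes "N \<ge> 1" and "M \<ge> 1" and "S \<ge> 1" and "T \<ge> 1"
    and "(\<Sum>n=1..N. \<bar>x n\<bar>) \<le> int M"
  shows "(N \<ge> M \<longrightarrow>
           (\<exists>g \<in> NN 1 1
              (nat (22 * max \<lceil>sqrt (real M) / (real S * sqrt (real T + 2))\<rceil>
                             \<lceil>(real N / real M) powr (1 / real T)\<rceil> + 10))
              (4 * S * (T + 2)).
             \<forall>n\<in>{1..N}. g (\<lambda>_. real n) 0 = real_of_int (x n)))
       \<and> (N \<le> M \<longrightarrow>
           (\<exists>g \<in> NN 1 1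
              (nat (22 * max \<lceil>real M / (real S * sqrt (real N * (real T + 2)))\<rceil>
                             \<lceil>(real M / real N) powr (1 / real T)\<rceil> + 12))
              (4 * nat \<lceil>real S * real N / real M\<rceil> * (T + 2)).
             \<forall>n\<in>{1..N}. g (\<lambda>_. real n) 0 = real_of_int (x n)))"
proof (intro conjI impI)
  let ?a = "\<lceil>sqrt (real M) / (real S * sqrt (real T + 2))\<rceil>"
  let ?b = "\<lceil>(real N / real M) powr (1 / real T)\<rceil>"
  \<comment> \<open>The root term is positive, so its ceiling and hence \<open>w\<close> are at
    least 1; the required width \<open>18 * w + 8\<close> lies below
    \<open>22 * w + 10\<close>.\<close>
  define w where "w = nat (max ?a ?b)"
  have "(real N / real M) powr (1 / real T) > 0" using assms by simp
  then have "max ?a ?b \<ge> 1" by linarith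
  then have w: "int w = max ?a ?b" "w \<ge> 1" unfolding w_def by linarith+
  have "real N \<le> real M * real w ^ T"
    by (rule ceiling_power_bound) (use assms w in auto)
  then have NM: "N \<le> M * w ^ T"
    by (simp only: of_nat_mult[symmetric] of_nat_power[symmetric] of_nat_le_iff)
  have "?a \<le> int w" using w by simp
  then have "sqrt (real M) / (real S * sqrt (real T + 2)) \<le> real w" by linarith
  then show "\<exists>g \<in> NN 1 1 (nat (22 * max ?a ?b + 10)) (4 * S * (T + 2)).
      \<forall>n\<in>{1..N}. g (\<lambda>_. real n) 0 = real_of_int (x n)"
    by (rule first_regime_network[OF assms(2-4) w(2) assms(5) _ NM]) (simp add: w(1)[symmetric])
next
  let ?a = "\<lceil>real M / (real S * sqrt (real N * (real T + 2)))\<rceil>"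
  let ?b = "\<lceil>(real M / real N) powr (1 / real T)\<rceil>"
  define w where "w = nat (max ?a ?b)"
  have "(real M / real N) powr (1 / real T) > 0" using assms by simp
  then have "max ?a ?b \<ge> 1" by linarith
  then have w: "int w = max ?a ?b" "w \<ge> 1" unfolding w_def by linarith+
  have "real M \<le> real N * real w ^ T"
    by (rule ceiling_power_bound) (use assms w in auto)
  then have MN: "M \<le> N * w ^ T"
    by (simp only: of_nat_mult[symmetric] of_nat_power[symmetric] of_nat_le_iff)
  have "?a \<le> int w" using w by simp
  then have a: "real M / (real S * sqrt (real N * (real T + 2))) \<le> real w" by linarith
  let ?S = "nat \<lceil>real S * real N / real M\<rceil>"
  have "real S * real N / real M > 0" using assms by simp
  \<comment> \<open>The rounded ratio takes over the role of \<open>S\<close> in the depth;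
    positivity of the quotient makes it at least 1.\<close>
  then have S: "?S \<ge> 1" "real S * real N / real M \<le> real ?S" by linarith+
  show "\<exists>g \<in> NN 1 1 (nat (22 * max ?a ?b + 12)) (4 * ?S * (T + 2)).
      \<forall>n\<in>{1..N}. g (\<lambda>_. real n) 0 = real_of_int (x n)"
    by (rule second_regime_network[OF assms(1-4) w(2) S(1) assms(5) a S(2) MN])
       (simp add: w(1)[symmetric])
qed

end
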